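(* Let $\mathbb{K}\in\{\mathbb{R},\mathbb{C}\}$, let $p$ be a point and $l$ a line of $\mathbb{K}^*\mathbb{P}^2$ that are almost incident, and let $M\in\mathrm{GL}_3(\mathbb{K}^* )$ be non-singular (in the non-standard sense that the determinant of an appreciable representative of $M$ is appreciable). Then the images of $p$ and $l$ under the projective transformation given by $M$, namely $[M_{\mathbb{A}}p_{\mathbb{A}}]$ and $[(M_{\mathbb{A}})^{-H}l_{\mathbb{A}}]$, are also almost incident.
   Context: $\mathbb{R}^*$ and $\mathbb{C}^*$ are the hyperreal and hypercomplex numbers of non-standard analysis ($\mathbb{C}^*=\mathbb{R}^*+i\,\mathbb{R}^*$). $\mathbb{I}$ is the set of infinitesimal numbers. A number $r$ is appreciable if $1/n<|r|<n$ for some $n\in\mathbb{N}$; $\mathbb{A}$ is the set of appreciable numbers. Points and lines of $\mathbb{K}^*\mathbb{P}^2$ are both given by elements of $((\mathbb{K}^* )^3\setminus\{0\})/(\mathbb{K}^*\setminus\{0\})$. $\|\cdot\|$ is the Euclidean norm on vectors and the Frobenius norm on matrices. For nonzero $r$, $\mathbf{mag}(r)=\{s\neq 0 : \exists A\in\mathbb{A},\ r=A s\}$. An appreciable representative of a point or line $x$ is $x_{\mathbb{A}}=\lambda^{-1}x$ with $\lambda\in\mathbf{mag}(\|x\|)$. An appreciable representative of a nonzero matrix $M$ is $M_{\mathbb{A}}=\lambda^{-1}M$ with $\lambda\in\mathbf{mag}(\|M\|)$. $M$ is non-singular if $\det(M_{\mathbb{A}})$ is appreciable. The (appreciable) projective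 transformation given by $M$ sends a point $p$ to $M_{\mathbb{A}}p_{\mathbb{A}}$ and a line $l$ to $(M_{\mathbb{A}})^{-H}l_{\mathbb{A}}$, where $M^{-H}=(\overline{M^{-1}})^T$. The appreciable scalar product is $\langle x,y\rangle_*=\langle x_{\mathbb{A}},y_{\mathbb{A}}\rangle$, where $\langle u,v\rangle=\overline{u}^{T}v$. A point $p$ and a line $l$ are almost incident if $\langle p,l\rangle_*\in\mathbb{I}$; this does not depend on the choice of appreciable representatives. *)

theory Defs
  imports "HOL-Analysis.Analysis" "Jordan_Normal_Form.Conjugate"
begin

section \<open>A free ultrafilter on the natural numbers\<close>

definition free_ultra :: "nat filter \<Rightarrow> bool" where
  "free_ultra F \<longleftrightarrow> F \<noteq> bot \<and> F \<le> cofinite \<and> (\<forall>P. eventually P F \<or> eventually (\<lambda>n. \<not> P n) F)"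

lemma free_ultra_exists: "\<exists>F. free_ultra F"
proof -
  define good :: "nat set set \<Rightarrow> bool" where
    "good A \<longleftrightarrow> (\<forall>S. finite S \<longrightarrow> S \<subseteq> A \<longrightarrow> infinite (\<Inter>S))" for A
  have "\<exists>M\<in>Collect good. \<forall>X\<in>Collect good. M \<subseteq> X \<longrightarrow> X = M"
  proof (rule subset_Zorn)
    fix C assume C: "subset.chain (Collect good) C"
    have "good (\<Union>C)"
    proof (cases "C = {}")
      case True
      then show ?thesis by (simp add: good_def)
    next
      case False
      have "infinite (\<Inter>S)" if S: "finite S" "S \<subseteq> \<Union>C" for S
      proof -
        obtain B where "B \<in> C" "S \<subseteq> B"
          by (rule finite_subset_Union_chain[OF S False C])
        with C have "good B" by (auto simp: subset_chain_def)
        with \<open>S \<subseteq> B\<close> S show ?thesis by (auto simp: good_def)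
      qed
      then show ?thesis by (simp add: good_def)
    qed
    then show "\<exists>U\<in>Collect good. \<forall>X\<in>C. X \<subseteq> U" by blast
  qed
  then obtain U where U: "good U" and max: "\<And>X. good X \<Longrightarrow> U \<subseteq> X \<Longrightarrow> X = U"
    by blast
  have out: "\<exists>S. finite S \<and> S \<subseteq> U \<and> finite (\<Inter>S \<inter> P)" if "P \<notin> U" for P
  proof -
    have "\<not> good (insert P U)" using max[of "insert P U"] that by blast
    then obtain S where S: "finite S" "S \<subseteq> insert P U" "finite (\<Inter>S)"
      unfolding good_def by metis
    have "\<Inter>(S - {P}) \<inter> P \<subseteq> \<Inter>S" by auto
    then have "finite (\<Inter>(S - {P}) \<inter> P)" using S(3) by (rule finite_subset)
    then show ?thesis
      using S by (intro exI[of _ "S - {P}"]) auto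
  qed
  have dich: "P \<in> U \<or> - P \<in> U" for P
  proof (rule ccontr)
    assume "\<not> ?thesis"
    then have "P \<notin> U" "- P \<notin> U" by simp_all
    then obtain S T where ST: "finite S" "S \<subseteq> U" "finite (\<Inter>S \<inter> P)"
        "finite T" "T \<subseteq> U" "finite (\<Inter>T \<inter> - P)"
      using out by meson
    have "\<Inter>(S \<union> T) \<subseteq> (\<Inter>S \<inter> P) \<union> (\<Inter>T \<inter> - P)" by (auto simp: Inf_union_distrib)
    then have "finite (\<Inter>(S \<union> T))" by (rule finite_subset) (use ST in simp)
    moreover have "finite (S \<union> T)" "S \<union> T \<subseteq> U" using ST by auto
    ultimately show False using U unfolding good_def by blast
  qed
  define F where "F = (INF S\<in>U. principal S)"
  have ev: "eventually (\<lambda>n. n \<in> S) F" if "S \<in> U" for S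
  proof (rule filter_leD)
    show "F \<le> principal S" unfolding F_def using that by (rule INF_lower)
  qed (simp add: eventually_principal)
  have "\<not> eventually (\<lambda>_. False) F"
  proof
    assume "eventually (\<lambda>_. False) F"
    then have "\<exists>X\<subseteq>U. finite X \<and> eventually (\<lambda>_. False) (INF S\<in>X. principal S)"
      unfolding F_def by (rule eventually_INF[THEN iffD1])
    then obtain X where X: "X \<subseteq> U" "finite X"
        "eventually (\<lambda>_. False) (INF S\<in>X. principal S)"
      by (elim exE conjE)
    from X(3) have "eventually (\<lambda>_. False) (principal (\<Inter>X))"
      using INF_principal_finite[OF X(2), of "\<lambda>S. S"] by (simp only: image_ident)
    then have "\<Inter>X = {}" unfolding eventually_principal by blast
    moreover have "infinite (\<Inter>X)" using U X(1,2) unfolding good_def by blast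
    ultimately show False by simp
  qed
  then have bot: "F \<noteq> bot" by (auto simp: trivial_limit_def)
  have "eventually P F \<or> eventually (\<lambda>n. \<not> P n) F" for P
    using dich[of "{n. P n}"] ev[of "{n. P n}"] ev[of "- {n. P n}"] by auto
  moreover have "F \<le> cofinite"
  proof (rule filter_leI)
    fix P :: "nat \<Rightarrow> bool" assume "eventually P cofinite"
    then have fin: "finite {n. \<not> P n}" by (simp add: eventually_cofinite)
    have "- {n. P n} \<notin> U"
    proof
      assume "- {n. P n} \<in> U"
      with U have "infinite (\<Inter>{- {n. P n}})"
        unfolding good_def by (meson empty_subsetI finite.emptyI finite.insertI insert_subset)
      with fin show False by (simp add: Collect_neg_eq)
    qed
    then show "eventually P F"
      using dich[of "{n. P n}"] ev[of "{n. P n}"] by auto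
  qed
  ultimately show ?thesis using bot unfolding free_ultra_def by blast
qed

definition ultra :: "nat filter" where
  "ultra = (SOME F. free_ultra F)"

lemma free_ultra_ultra: "free_ultra ultra"
  unfolding ultra_def using free_ultra_exists by (rule someI_ex)

lemma ultra_neq_bot [simp]: "ultra \<noteq> bot"
  using free_ultra_ultra by (simp add: free_ultra_def)

lemma not_eventually_ultra: "\<not> eventually P ultra \<longleftrightarrow> eventually (\<lambda>n. \<not> P n) ultra"
proof
  show "\<not> eventually P ultra \<Longrightarrow> eventually (\<lambda>n. \<not> P n) ultra"
    using free_ultra_ultra by (auto simp: free_ultra_def)
  show "eventually (\<lambda>n. \<not> P n) ultra \<Longrightarrow> \<not> eventually P ultra"
    using eventually_conj[of P ultra "\<lambda>n. \<not> P n"] by auto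
qed


section \<open>Ultrapowers\<close>

quotient_type 'a star = "nat \<Rightarrow> 'a" / "\<lambda>X Y. eventually (\<lambda>n. X n = Y n) ultra"
  morphisms rep_seq of_seq
  by (intro equivpI reflpI sympI transpI) (auto elim: eventually_elim2 simp: eq_commute)

lift_definition star_map :: "('a \<Rightarrow> 'b) \<Rightarrow> 'a star \<Rightarrow> 'b star" is "\<lambda>f X n. f (X n)"
  by (auto elim: eventually_mono)

lift_definition star_of :: "'a \<Rightarrow> 'a star" is "\<lambda>x _. x" .

instantiation star :: (field) comm_ring_1
begin

lift_definition zero_star :: "'a star" is "\<lambda>_. 0" .
lift_definition one_star :: "'a star" is "\<lambda>_. 1" .
lift_definition plus_star :: "'a star \<Rightarrow> 'a star \<Rightarrow> 'a star" is "\<lambda>X Y n. X n + Y n"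
  by (auto elim: eventually_elim2)
lift_definition minus_star :: "'a star \<Rightarrow> 'a star \<Rightarrow> 'a star" is "\<lambda>X Y n. X n - Y n"
  by (auto elim: eventually_elim2)
lift_definition times_star :: "'a star \<Rightarrow> 'a star \<Rightarrow> 'a star" is "\<lambda>X Y n. X n * Y n"
  by (auto elim: eventually_elim2)
lift_definition uminus_star :: "'a star \<Rightarrow> 'a star" is "\<lambda>X n. - X n"
  by (auto elim: eventually_mono)

instance
proof
  fix a b c :: "'a star"
  show "a * b * c = a * (b * c)" "a * b = b * a" "1 * a = a" "(a + b) * c = a * c + b * c"
    "a + b + c = a + (b + c)" "a + b = b + a" "0 + a = a" "- a + a = 0" "a - b = a + - b"
    by (transfer; simp add: algebra_simps)+
  show "0 \<noteq> (1 :: 'a star)"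
    by transfer simp
qed

end

instantiation star :: (field) inverse
begin

lift_definition divide_star :: "'a star \<Rightarrow> 'a star \<Rightarrow> 'a star" is "\<lambda>X Y n. X n / Y n"
  by (auto elim: eventually_elim2)
lift_definition inverse_star :: "'a star \<Rightarrow> 'a star" is "\<lambda>X n. inverse (X n)"
  by (auto elim: eventually_mono)

instance ..

end

instance star :: (field) field
proof
  fix a b :: "'a star"
  show "a / b = a * inverse b" "inverse 0 = (0 :: 'a star)"
    by (transfer; simp add: divide_inverse)+
  show "a \<noteq> 0 \<Longrightarrow> inverse a * a = 1"
    by transfer (auto simp: not_eventually_ultra elim: eventually_mono)
qed

instantiation star :: (linordered_field) linordered_field
begin

lift_definition less_eq_star :: "'a star \<Rightarrow> 'a star \<Rightarrow> bool"
  is "\<lambda>X Y. eventually (\<lambda>n. X n \<le> Y n) ultra"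
  by (rule iffI; elim eventually_rev_mp; auto elim!: eventually_mono)
lift_definition less_star :: "'a star \<Rightarrow> 'a star \<Rightarrow> bool"
  is "\<lambda>X Y. eventually (\<lambda>n. X n < Y n) ultra"
  by (rule iffI; elim eventually_rev_mp; auto elim!: eventually_mono)
lift_definition abs_star :: "'a star \<Rightarrow> 'a star" is "\<lambda>X n. \<bar>X n\<bar>"
  by (auto elim: eventually_mono)
lift_definition sgn_star :: "'a star \<Rightarrow> 'a star" is "\<lambda>X n. sgn (X n)"
  by (auto elim: eventually_mono)

instance
proof
  fix a b c :: "'a star"
  show le_less: "(a < b) = (a \<le> b \<and> \<not> b \<le> a)"
    by transfer (auto simp: not_eventually_ultra not_le elim: eventually_mono)
  show "a \<le> a" by transfer simp
  show "a \<le> b \<Longrightarrow> b \<le> c \<Longrightarrow> a \<le> c"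
    by transfer (auto elim: eventually_elim2)
  show "a \<le> b \<Longrightarrow> b \<le> a \<Longrightarrow> a = b"
    by transfer (auto elim: eventually_elim2)
  show "a \<le> b \<or> b \<le> a"
    by transfer (metis (mono_tags, lifting) eventually_mono linear not_eventually_ultra)
  show "a \<le> b \<Longrightarrow> c + a \<le> c + b"
    by transfer (auto elim: eventually_mono)
  show "a < b \<Longrightarrow> 0 < c \<Longrightarrow> c * a < c * b"
    by transfer (auto elim: eventually_elim2)
  show "\<bar>a\<bar> = (if a < 0 then - a else a)"
    by transfer (auto simp: not_eventually_ultra elim: eventually_mono)
  show "sgn a = (if a = 0 then 0 else if 0 < a then 1 else - 1)"
    by transfer (auto simp: not_eventually_ultra sgn_if elim: eventually_elim2 eventually_mono)
qed

end

instantiation star :: (conjugatable_field) conjugatable_field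
begin

definition conjugate_star :: "'a star \<Rightarrow> 'a star" where
  "conjugate_star = star_map conjugate"

instance
proof
  fix a b :: "'a star"
  show "conjugate (conjugate a) = a" "(conjugate a = conjugate b) = (a = b)"
    "conjugate (a * b) = conjugate a * conjugate b"
    "conjugate (a + b) = conjugate a + conjugate b"
    "conjugate (- a) = - conjugate a" "conjugate (0 :: 'a star) = 0"
    unfolding conjugate_star_def
    by (transfer; simp add: conjugate_dist_mul conjugate_dist_add conjugate_neg)+
qed

end


class normed_conjugatable_field = real_normed_field + conjugatable_field +
  assumes norm_conjugate: "norm (conjugate x) = norm x"

instance real :: normed_conjugatable_field
  by standard simp

instance complex :: normed_conjugatable_field
  by standard simp


section \<open>Hyperreal and hypercomplex numbers\<close>

text \<open>The hypercomplex numbers are taken as the ultrapower of the complex numbers;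
  \<open>hypercomplex_Re_Im\<close> and \<open>hypercomplex_operations\<close> identify them with pairs of hyperreals.\<close>

type_synonym hyperreal = "real star"
type_synonym hypercomplex = "complex star"

definition hyper_of_real :: "hyperreal \<Rightarrow> 'a::real_normed_field star" where
  "hyper_of_real = star_map of_real"

definition hmod :: "'a::real_normed_field star \<Rightarrow> hyperreal" where
  "hmod = star_map norm"

definition hsqrt :: "hyperreal \<Rightarrow> hyperreal" where
  "hsqrt = star_map sqrt"

definition hyper_ii :: hypercomplex where
  "hyper_ii = star_of \<i>"

lemma hyper_of_real_hyperreal: "hyper_of_real (x::hyperreal) = x"
  unfolding hyper_of_real_def by transfer simp

lemma hmod_hyperreal: "hmod (x::hyperreal) = \<bar>x\<bar>"
  unfolding hmod_def by transfer simp

lemma conjugate_hyperreal: "conjugate (x::hyperreal) = x"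
  unfolding conjugate_star_def by transfer simp

lemma hyper_ii_squared: "hyper_ii * hyper_ii = - 1"
  unfolding hyper_ii_def by transfer simp

lemma hypercomplex_Re_Im:
  fixes z :: hypercomplex
  shows "\<exists>!(x, y). z = hyper_of_real x + hyper_ii * hyper_of_real y"
proof -
  have split: "w = hyper_of_real (star_map Re w) + hyper_ii * hyper_of_real (star_map Im w)"
    for w :: hypercomplex
    unfolding hyper_ii_def hyper_of_real_def by transfer (simp add: complex_eq)
  have Re: "star_map Re (hyper_of_real x + hyper_ii * hyper_of_real y) = x" for x y
    unfolding hyper_ii_def hyper_of_real_def by transfer simp
  have Im: "star_map Im (hyper_of_real x + hyper_ii * hyper_of_real y) = y" for x y
    unfolding hyper_ii_def hyper_of_real_def by transfer simp
  show ?thesis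
    using split[of z] Re Im by (intro ex1I[of _ "(star_map Re z, star_map Im z)"]) auto
qed

lemma hypercomplex_operations:
  fixes x y :: hyperreal
  shows "conjugate (hyper_of_real x + hyper_ii * hyper_of_real y)
      = hyper_of_real x - hyper_ii * hyper_of_real y"
    and "hmod (hyper_of_real x + hyper_ii * hyper_of_real y) = hsqrt (x^2 + y^2)"
proof -
  show "conjugate (hyper_of_real x + hyper_ii * hyper_of_real y)
      = hyper_of_real x - hyper_ii * hyper_of_real y"
    unfolding conjugate_star_def hyper_ii_def hyper_of_real_def
    by transfer (simp add: complex_eq_iff)
  show "hmod (hyper_of_real x + hyper_ii * hyper_of_real y) = hsqrt (x^2 + y^2)"
    unfolding hmod_def hsqrt_def hyper_ii_def hyper_of_real_def power2_eq_square
    by transfer (simp add: cmod_def power2_eq_square)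
qed

lemma hmod_mult: "hmod (x * y) = hmod x * hmod y"
  unfolding hmod_def by transfer (simp add: norm_mult)

lemma hmod_inverse: "hmod (inverse x) = inverse (hmod x)"
  for x :: "'a::real_normed_field star"
  unfolding hmod_def by transfer (simp add: norm_inverse)

lemma hmod_ge_0 [simp]: "0 \<le> hmod x"
  unfolding hmod_def by transfer simp

lemma hmod_eq_0_iff [simp]: "hmod x = 0 \<longleftrightarrow> x = 0"
  unfolding hmod_def by transfer simp

lemma hmod_0 [simp]: "hmod 0 = 0"
  by simp

lemma hmod_hyper_of_real: "hmod (hyper_of_real x :: 'a::real_normed_field star) = \<bar>x\<bar>"
  unfolding hmod_def hyper_of_real_def by transfer simp

lemma hsqrt_square: "0 \<le> x \<Longrightarrow> (hsqrt x)\<^sup>2 = x"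
  unfolding hsqrt_def power2_eq_square by transfer (auto elim: eventually_mono)

lemma hsqrt_ge_0: "0 \<le> x \<Longrightarrow> 0 \<le> hsqrt x"
  unfolding hsqrt_def by transfer (auto elim: eventually_mono)

definition infinitesimal :: "'a::real_normed_field star set" where
  "infinitesimal = {r. \<forall>n::nat. n > 0 \<longrightarrow> hmod r < 1 / of_nat n}"

definition appreciable :: "'a::real_normed_field star set" where
  "appreciable = {r. \<exists>n::nat. 1 / of_nat n < hmod r \<and> hmod r < of_nat n}"

definition mag :: "'a::real_normed_field star \<Rightarrow> 'a star set" where
  "mag r = {s. s \<noteq> 0 \<and> (\<exists>A\<in>appreciable. r = A * s)}"


section \<open>The projective plane and appreciable representatives\<close>

quotient_type (overloaded) 'a proj_plane = "('a::field)^3" /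
  partial: "\<lambda>x y. x \<noteq> 0 \<and> y \<noteq> 0 \<and> (\<exists>c. c \<noteq> 0 \<and> y = c *s x)"
  morphisms rep_proj_plane proj_class
proof (rule part_equivpI)
  show "\<exists>x::'a^3. x \<noteq> 0 \<and> x \<noteq> 0 \<and> (\<exists>c. c \<noteq> 0 \<and> x = c *s x)"
    by (intro exI[of _ "1 :: 'a^3"] conjI exI[of _ "1 :: 'a"]) (simp_all add: vec_eq_iff)
  show "symp (\<lambda>x y::'a^3. x \<noteq> 0 \<and> y \<noteq> 0 \<and> (\<exists>c. c \<noteq> 0 \<and> y = c *s x))"
  proof (intro sympI, elim conjE exE, intro conjI)
    fix x y :: "'a^3" and c assume "c \<noteq> 0" "y = c *s x"
    then show "\<exists>c. c \<noteq> 0 \<and> x = c *s y"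
      by (intro exI[of _ "inverse c"]) simp
  qed
  show "transp (\<lambda>x y::'a^3. x \<noteq> 0 \<and> y \<noteq> 0 \<and> (\<exists>c. c \<noteq> 0 \<and> y = c *s x))"
    by (intro transpI, elim conjE exE, intro conjI)
       (auto simp: vector_smult_assoc intro!: exI[of _ "_ * _"])
qed

definition hnorm :: "'a::real_normed_field star ^ 'n \<Rightarrow> hyperreal" where
  "hnorm x = hsqrt (\<Sum>i\<in>UNIV. (hmod (x $ i))\<^sup>2)"

definition frobenius :: "'a::real_normed_field star ^ 'n ^ 'm \<Rightarrow> hyperreal" where
  "frobenius M = hsqrt (\<Sum>i\<in>UNIV. \<Sum>j\<in>UNIV. (hmod (M $ i $ j))\<^sup>2)"

text \<open>The magnitude of a norm is taken among all scalars of the field, so over the hypercomplex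
  numbers an appreciable representative may also be rescaled by a non-real scalar.\<close>

definition appreciable_reps :: "'a::real_normed_field star proj_plane \<Rightarrow> ('a star ^ 3) set" where
  "appreciable_reps p =
     {inverse c *s x | c x. x \<noteq> 0 \<and> proj_class x = p \<and> c \<in> mag (hyper_of_real (hnorm x))}"

definition appreciable_matrix_reps ::
    "'a::real_normed_field star ^ 'n ^ 'm \<Rightarrow> ('a star ^ 'n ^ 'm) set" where
  "appreciable_matrix_reps M =
     {(\<chi> i j. inverse c * M $ i $ j) | c. c \<in> mag (hyper_of_real (frobenius M))}"

definition herm_product :: "'a::conjugatable_field ^ 'n \<Rightarrow> 'a ^ 'n \<Rightarrow> 'a" where
  "herm_product u v = (\<Sum>i\<in>UNIV. conjugate (u $ i) * v $ i)"

definition conj_transpose :: "'a::conjugatable_field ^ 'n ^ 'm \<Rightarrow> 'a ^ 'm ^ 'n" where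
  "conj_transpose M = (\<chi> i j. conjugate (M $ j $ i))"

text \<open>Both notions below are independent of the representatives, see
  \<open>almost_incident_iff\<close> and \<open>nonsingular_iff\<close>.\<close>

definition almost_incident ::
    "'a::normed_conjugatable_field star proj_plane \<Rightarrow> 'a star proj_plane \<Rightarrow> bool" where
  "almost_incident p l \<longleftrightarrow>
     (\<exists>u\<in>appreciable_reps p. \<exists>v\<in>appreciable_reps l. herm_product u v \<in> infinitesimal)"

definition nonsingular :: "'a::real_normed_field star ^ 'n ^ 'n \<Rightarrow> bool" where
  "nonsingular M \<longleftrightarrow> (\<exists>N\<in>appreciable_matrix_reps M. det N \<in> appreciable)"

lemma hmod_conjugate: "hmod (conjugate x) = hmod x"
  for x :: "'a::normed_conjugatable_field star"
  unfolding hmod_def conjugate_star_def by transfer (simp add: norm_conjugate)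

lemma hnorm_scale:
  fixes x :: "'a::real_normed_field star ^ 'n"
  shows "hnorm (c *s x) = hmod c * hnorm x"
proof -
  let ?S = "\<Sum>i\<in>UNIV. (hmod (x $ i))\<^sup>2"
  have "hnorm (c *s x) = hsqrt ((hmod c)\<^sup>2 * ?S)"
    by (simp add: hnorm_def hmod_mult power_mult_distrib sum_distrib_left)
  also have "\<dots> = hmod c * hsqrt ?S"
  proof (rule power2_eq_imp_eq)
    show "(hsqrt ((hmod c)\<^sup>2 * ?S))\<^sup>2 = (hmod c * hsqrt ?S)\<^sup>2"
      by (simp add: hsqrt_square power_mult_distrib sum_nonneg)
  qed (simp_all add: hsqrt_ge_0 sum_nonneg)
  finally show ?thesis by (simp add: hnorm_def)
qed

lemma hnorm_eq_0_iff: "hnorm x = 0 \<longleftrightarrow> x = 0"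
  for x :: "'a::real_normed_field star ^ 'n"
proof -
  let ?S = "\<Sum>i\<in>UNIV. (hmod (x $ i))\<^sup>2"
  have S: "0 \<le> ?S" by (simp add: sum_nonneg)
  have "hnorm x = 0 \<longleftrightarrow> ?S = 0"
    using hsqrt_square[OF S] hsqrt_square[of 0] by (auto simp: hnorm_def)
  also have "\<dots> \<longleftrightarrow> x = 0"
    by (subst sum_nonneg_eq_0_iff) (auto simp: vec_eq_iff)
  finally show ?thesis .
qed

lemma frobenius_eq_0_iff: "frobenius M = 0 \<longleftrightarrow> M = 0"
  for M :: "'a::real_normed_field star ^ 'n ^ 'm"
proof -
  let ?S = "\<Sum>i\<in>UNIV. \<Sum>j\<in>UNIV. (hmod (M $ i $ j))\<^sup>2"
  have S: "0 \<le> ?S" by (simp add: sum_nonneg)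
  have "frobenius M = 0 \<longleftrightarrow> ?S = 0"
    using hsqrt_square[OF S] hsqrt_square[of 0] by (auto simp: frobenius_def)
  also have "\<dots> \<longleftrightarrow> M = 0"
    by (simp add: sum_nonneg_eq_0_iff sum_nonneg vec_eq_iff)
  finally show ?thesis .
qed

lemma of_nat_less_scaled:
  fixes x y :: "'a::linordered_field"
  assumes "n > 0" "0 \<le> x" "x < of_nat m" "y < 1 / of_nat (m * n)"
  shows "x * y < 1 / of_nat n"
proof (cases "x = 0")
  case True
  then show ?thesis using assms by simp
next
  case False
  have m: "0 < x" "(0::'a) < of_nat m"
    using False assms(2) le_less_trans[OF assms(2,3)] by simp_all
  then have "m > 0" by simp
  note m = m this
  have "x * y < x * (1 / of_nat (m * n))"
    using m assms by (intro mult_strict_left_mono) auto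
  also have "\<dots> \<le> of_nat m * (1 / of_nat (m * n))"
    using assms by (intro mult_right_mono) auto
  also have "\<dots> = 1 / of_nat n" using m by (simp add: field_simps)
  finally show ?thesis .
qed

lemma appreciable_mult:
  assumes "x \<in> appreciable" "y \<in> appreciable"
  shows "x * y \<in> appreciable"
proof -
  from assms obtain m n :: nat where
    mn: "1 / of_nat m < hmod x" "hmod x < of_nat m" "1 / of_nat n < hmod y" "hmod y < of_nat n"
    unfolding appreciable_def by blast
  have pos: "0 < hmod x" "0 < hmod y"
    using mn by (meson divide_nonneg_nonneg le_less_trans of_nat_0_le_iff zero_le_one)+
  have "(0::hyperreal) < of_nat m" "(0::hyperreal) < of_nat n"
    using mn pos by (meson less_trans)+
  then have pos': "0 < m" "0 < n" by simp_all
  have "1 / of_nat m * (1 / of_nat n) < hmod x * hmod y"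
    using mn pos pos' by (intro mult_strict_mono) simp_all
  moreover have "hmod x * hmod y < of_nat m * of_nat n"
    using mn pos pos' by (intro mult_strict_mono) simp_all
  ultimately show ?thesis
    unfolding appreciable_def by (auto simp: hmod_mult intro!: exI[of _ "m * n"])
qed

lemma appreciable_inverse:
  assumes "x \<in> appreciable"
  shows "inverse x \<in> appreciable"
proof -
  from assms obtain m :: nat where m: "1 / of_nat m < hmod x" "hmod x < of_nat m"
    unfolding appreciable_def by blast
  have pos: "0 < hmod x" "(0::hyperreal) < of_nat m"
    using m by (meson divide_nonneg_nonneg hmod_ge_0 le_less_trans of_nat_0_le_iff zero_le_one)+
  show ?thesis
    unfolding appreciable_def mem_Collect_eq hmod_inverse using m pos
    by (intro exI[of _ m]) (simp add: field_simps)
qed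

lemma appreciable_neq_0: "x \<in> appreciable \<Longrightarrow> x \<noteq> 0"
  for x :: "'a::real_normed_field star"
proof
  assume "x \<in> appreciable" "x = 0"
  then obtain m :: nat where "1 / of_nat m < hmod (0 :: 'a star)"
    unfolding appreciable_def by blast
  then have "1 / of_nat m < (0::hyperreal)" by simp
  then show False by (simp add: divide_less_0_iff)
qed

lemma one_appreciable: "(1 :: 'a::real_normed_field star) \<in> appreciable"
proof -
  have "hmod (1 :: 'a star) = 1" unfolding hmod_def by transfer simp
  then show ?thesis unfolding appreciable_def by (auto intro!: exI[of _ 2])
qed

lemma appreciable_mult_infinitesimal:
  assumes "x \<in> appreciable" "y \<in> infinitesimal"
  shows "x * y \<in> infinitesimal"
proof -
  from assms obtain m :: nat where m: "1 / of_nat m < hmod x" "hmod x < of_nat m"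
    unfolding appreciable_def by blast
  have "(0::hyperreal) < of_nat m" by (rule le_less_trans[OF hmod_ge_0 m(2)])
  then have "m > 0" by simp
  show ?thesis
    unfolding infinitesimal_def mem_Collect_eq hmod_mult
  proof (intro allI impI)
    fix n :: nat assume "n > 0"
    with \<open>m > 0\<close> have "hmod y < 1 / of_nat (m * n)"
      using assms(2) unfolding infinitesimal_def mem_Collect_eq by (meson nat_0_less_mult_iff)
    with \<open>n > 0\<close> m(2) show "hmod x * hmod y < 1 / of_nat n"
      by (intro of_nat_less_scaled) simp_all
  qed
qed

lemma appreciable_conjugate: "conjugate x \<in> appreciable \<longleftrightarrow> x \<in> appreciable"
  for x :: "'a::normed_conjugatable_field star"
  by (simp add: appreciable_def hmod_conjugate)

lemma appreciable_cong_hmod: "hmod x = hmod y \<Longrightarrow> x \<in> appreciable \<longleftrightarrow> y \<in> appreciable"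
  by (simp add: appreciable_def)

lemma mag_self: "r \<noteq> 0 \<Longrightarrow> r \<in> mag r"
  unfolding mag_def using one_appreciable by force

lemma proj_class_eq_iff:
  assumes "x \<noteq> 0" "y \<noteq> 0"
  shows "proj_class x = proj_class y \<longleftrightarrow> (\<exists>c. c \<noteq> 0 \<and> y = c *s x)"
proof -
  have refl: "\<exists>c. c \<noteq> 0 \<and> z = c *s z" for z :: "'a ^ 3"
    by (rule exI[of _ 1]) simp
  show ?thesis
    using Quotient3_rel[OF Quotient3_proj_plane, of x y] assms refl[of x] refl[of y] by simp
qed

lemma appreciable_reps_nonempty: "\<exists>u. u \<in> appreciable_reps p"
proof -
  obtain x where x: "x \<noteq> 0" "proj_class x = p"
    using Quotient3_rep_reflp[OF Quotient3_proj_plane, of p]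
      Quotient3_abs_rep[OF Quotient3_proj_plane, of p] by blast
  have "hyper_of_real (hnorm x) \<noteq> (0 :: 'a star)"
    using x by (metis abs_eq_0_iff hmod_eq_0_iff hmod_hyper_of_real hnorm_eq_0_iff)
  then show ?thesis
    unfolding appreciable_reps_def using x mag_self by blast
qed

lemma appreciable_matrix_reps_nonempty:
  assumes "M \<noteq> 0"
  shows "\<exists>N. N \<in> appreciable_matrix_reps M"
proof -
  have "hyper_of_real (frobenius M) \<noteq> (0 :: 'a star)"
    using assms by (metis abs_eq_0_iff hmod_eq_0_iff hmod_hyper_of_real frobenius_eq_0_iff)
  then show ?thesis
    unfolding appreciable_matrix_reps_def using mag_self by blast
qed

lemma appreciable_reps_related:
  assumes "u \<in> appreciable_reps p" "v \<in> appreciable_reps p"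
  shows "\<exists>d\<in>appreciable. v = d *s u"
proof -
  obtain c x where u: "u = inverse c *s x" "x \<noteq> 0" "proj_class x = p"
      "c \<in> mag (hyper_of_real (hnorm x))"
    using assms unfolding appreciable_reps_def by blast
  obtain d y where v: "v = inverse d *s y" "y \<noteq> 0" "proj_class y = p"
      "d \<in> mag (hyper_of_real (hnorm y))"
    using assms unfolding appreciable_reps_def by blast
  obtain k where k: "k \<noteq> 0" "y = k *s x"
    using u v proj_class_eq_iff by metis
  obtain A where A: "c \<noteq> 0" "A \<in> appreciable" "hyper_of_real (hnorm x) = A * c"
    using u unfolding mag_def by blast
  obtain B where B: "d \<noteq> 0" "B \<in> appreciable" "hyper_of_real (hnorm y) = B * d"
    using v unfolding mag_def by blast
  have nz: "A \<noteq> 0" "B \<noteq> 0" using A B appreciable_neq_0 by auto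
  have "\<bar>hnorm x\<bar> = hmod A * hmod c" "\<bar>hnorm y\<bar> = hmod B * hmod d"
    using A B by (metis hmod_hyper_of_real hmod_mult)+
  moreover have "\<bar>hnorm y\<bar> = hmod k * \<bar>hnorm x\<bar>"
    by (simp add: k hnorm_scale abs_mult)
  ultimately have "hmod k * (hmod A * hmod c) = hmod B * hmod d" by simp
  then have "hmod (inverse d * k * c) = hmod (B * inverse A)"
    using A B nz unfolding hmod_mult hmod_inverse by (simp add: field_simps)
  moreover have "B * inverse A \<in> appreciable"
    using A B by (intro appreciable_mult appreciable_inverse)
  ultimately have "inverse d * k * c \<in> appreciable"
    using appreciable_cong_hmod by blast
  moreover have "v = (inverse d * k * c) *s u"
    using A by (simp add: u v k vector_smult_assoc)
  ultimately show ?thesis by blast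
qed

lemma appreciable_matrix_reps_related:
  assumes "N \<in> appreciable_matrix_reps M" "N' \<in> appreciable_matrix_reps M"
  shows "\<exists>d\<in>appreciable. N' = (\<chi> i j. d * N $ i $ j)"
proof -
  obtain c A where c: "N = (\<chi> i j. inverse c * M $ i $ j)" "c \<noteq> 0" "A \<in> appreciable"
      "hyper_of_real (frobenius M) = A * c"
    using assms unfolding appreciable_matrix_reps_def mag_def by blast
  obtain d B where d: "N' = (\<chi> i j. inverse d * M $ i $ j)" "d \<noteq> 0" "B \<in> appreciable"
      "hyper_of_real (frobenius M) = B * d"
    using assms unfolding appreciable_matrix_reps_def mag_def by blast
  have "A \<noteq> 0" using c appreciable_neq_0 by auto
  then have "inverse d * c = B * inverse A"
    using c d by (simp add: field_simps)
  then have "inverse d * c \<in> appreciable"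
    using c d appreciable_mult appreciable_inverse by metis
  moreover have "N' = (\<chi> i j. (inverse d * c) * N $ i $ j)"
    using c d by (simp add: vec_eq_iff)
  ultimately show ?thesis by blast
qed

lemma herm_product_scale:
  "herm_product (c *s u) (d *s v) = (conjugate c * d) * herm_product u v"
  by (simp add: herm_product_def conjugate_dist_mul sum_distrib_left mult_ac)

lemma almost_incident_iff:
  assumes "u \<in> appreciable_reps p" "v \<in> appreciable_reps l"
  shows "almost_incident p l \<longleftrightarrow> herm_product u v \<in> infinitesimal"
proof
  assume "almost_incident p l"
  then obtain u' v' where uv: "u' \<in> appreciable_reps p" "v' \<in> appreciable_reps l"
      "herm_product u' v' \<in> infinitesimal"
    unfolding almost_incident_def by blast
  obtain c d where "c \<in> appreciable" "u = c *s u'" "d \<in> appreciable" "v = d *s v'"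
    using appreciable_reps_related uv assms by metis
  then show "herm_product u v \<in> infinitesimal"
    using uv by (auto simp: herm_product_scale appreciable_conjugate
        intro!: appreciable_mult_infinitesimal appreciable_mult)
qed (use assms in \<open>auto simp: almost_incident_def\<close>)

lemma nonsingular_iff:
  assumes "N \<in> appreciable_matrix_reps M"
  shows "nonsingular M \<longleftrightarrow> det N \<in> appreciable"
proof
  assume "nonsingular M"
  then obtain N' where N': "N' \<in> appreciable_matrix_reps M" "det N' \<in> appreciable"
    unfolding nonsingular_def by blast
  obtain d where d: "d \<in> appreciable" "N = (\<chi> i j. d * N' $ i $ j)"
    using appreciable_matrix_reps_related N' assms by blast
  have "N = (\<chi> i. d *s N' $ i)"
    by (simp add: d vec_eq_iff)
  then have "det N = d ^ CARD('b) * det N'"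
    by (simp add: det_rows_mul)
  moreover have "d ^ n \<in> appreciable" for n :: nat
    by (induction n) (simp_all add: one_appreciable appreciable_mult d)
  ultimately show "det N \<in> appreciable"
    using N' by (simp add: appreciable_mult)
qed (use assms in \<open>auto simp: nonsingular_def\<close>)

end

theory Submission
  imports Defs
begin

text \<open>
  Sending \<open>p\<close> through a matrix \<open>N\<close> and \<open>l\<close> through \<open>N\<^sup>-\<^sup>H\<close> preserves the Hermitian product of the
  chosen representatives exactly, because \<open>N\<^sup>-\<^sup>H\<close> moves to the other side as \<open>N\<^sup>-\<^sup>1\<close>
  (\<open>herm_product_inverse_conj_transpose\<close>). So the only thing to prove is that passing from the
  vectors \<open>N u\<close> and \<open>N\<^sup>-\<^sup>H v\<close> to appreciable representatives of their classes cannot turn an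
  infinitesimal product into a non-infinitesimal one. Dividing by the norm
  gives an appreciable representative, so it suffices that neither norm is infinitesimal, that is,
  that its inverse is limited (bounded by a standard number).

  A vector \<open>w\<close> cannot be that short if a matrix with limited entries maps it to a
  vector of appreciable norm (\<open>limited_inverse_hnorm\<close>). Here \<open>N\<^sup>-\<^sup>1\<close> maps \<open>N u\<close> to \<open>u\<close> and
  \<open>N\<^sup>H\<close> maps \<open>N\<^sup>-\<^sup>H v\<close> to \<open>v\<close>. The entries of \<open>N\<close> are limited because its Frobenius
  norm is appreciable. Those of \<open>N\<^sup>-\<^sup>1\<close> are limited by Cramer's rule: they are
  quotients of determinants with limited entries by \<open>det N\<close>, which is appreciable
  (\<open>limited_matrix_inv\<close>); this is where non-singularity in the non-standard sense enters, as
  an infinitesimal nonzero determinant would allow an unlimited inverse.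
\<close>

section \<open>Limited numbers\<close>

definition limited :: "'a::real_normed_field star set" where
  "limited = {r. \<exists>n::nat. hmod r < of_nat n}"

lemma hmod_triangle: "hmod (x + y) \<le> hmod x + hmod y"
  unfolding hmod_def by transfer (simp add: norm_triangle_ineq)

lemma hmod_minus: "hmod (- x) = hmod x"
  unfolding hmod_def by transfer simp

lemma limited_of_hmod_le:
  assumes "hmod x \<le> hmod y" "y \<in> limited"
  shows "x \<in> limited"
  using assms le_less_trans unfolding limited_def by blast

lemma limited_0: "0 \<in> limited"
  unfolding limited_def by (auto intro!: exI[of _ 1])

lemma appreciable_limited: "x \<in> appreciable \<Longrightarrow> x \<in> limited"
  by (auto simp: appreciable_def limited_def)

lemma limited_1: "1 \<in> limited"
  by (rule appreciable_limited[OF one_appreciable])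

lemma limited_add:
  assumes "x \<in> limited" "y \<in> limited"
  shows "x + y \<in> limited"
proof -
  obtain m n :: nat where "hmod x < of_nat m" "hmod y < of_nat n"
    using assms unfolding limited_def by blast
  then have "hmod (x + y) < of_nat (m + n)"
    using hmod_triangle[of x y] by simp
  then show ?thesis unfolding limited_def by blast
qed

lemma limited_mult:
  assumes "x \<in> limited" "y \<in> limited"
  shows "x * y \<in> limited"
proof -
  obtain m n :: nat where "hmod x < of_nat m" "hmod y < of_nat n"
    using assms unfolding limited_def by blast
  then have "hmod (x * y) < of_nat (m * n)"
    unfolding hmod_mult of_nat_mult by (intro mult_strict_mono') simp_all
  then show ?thesis unfolding limited_def by blast
qed

lemma limited_sum: "(\<And>i. i \<in> A \<Longrightarrow> f i \<in> limited) \<Longrightarrow> sum f A \<in> limited"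
  by (induction A rule: infinite_finite_induct) (auto simp: limited_0 limited_add)

lemma limited_prod: "(\<And>i. i \<in> A \<Longrightarrow> f i \<in> limited) \<Longrightarrow> prod f A \<in> limited"
  by (induction A rule: infinite_finite_induct) (auto simp: limited_1 limited_mult)

lemma limited_conjugate: "conjugate x \<in> limited \<longleftrightarrow> x \<in> limited"
  for x :: "'a::normed_conjugatable_field star"
  by (simp add: limited_def hmod_conjugate)

lemma limited_power2_iff: "x\<^sup>2 \<in> limited \<longleftrightarrow> x \<in> limited"
proof
  assume "x\<^sup>2 \<in> limited"
  then obtain n :: nat where n: "(hmod x)\<^sup>2 < of_nat n"
    unfolding limited_def by (auto simp: power2_eq_square hmod_mult)
  \<comment> \<open>\<open>n \<le> n\<^sup>2\<close>, so the same bound serves for the square root.\<close>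
  also have "of_nat n \<le> (of_nat n :: hyperreal)\<^sup>2"
    unfolding of_nat_power[symmetric] of_nat_le_iff by (simp add: power2_eq_square)
  finally have "hmod x < of_nat n"
    by (rule power2_less_imp_less) simp
  then show "x \<in> limited" unfolding limited_def by blast
qed (simp add: power2_eq_square limited_mult)

lemma limited_mult_infinitesimal:
  assumes "x \<in> limited" "y \<in> infinitesimal"
  shows "x * y \<in> infinitesimal"
proof -
  obtain m :: nat where m: "hmod x < of_nat m"
    using assms unfolding limited_def by blast
  have "(0::hyperreal) < of_nat m" by (rule le_less_trans[OF hmod_ge_0 m])
  then have "m > 0" by simp
  show ?thesis
    unfolding infinitesimal_def mem_Collect_eq hmod_mult
  proof (intro allI impI)
    fix n :: nat assume "n > 0"
    with \<open>m > 0\<close> have "hmod y < 1 / of_nat (m * n)"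
      using assms(2) unfolding infinitesimal_def mem_Collect_eq by (meson nat_0_less_mult_iff)
    with \<open>n > 0\<close> m show "hmod x * hmod y < 1 / of_nat n"
      by (intro of_nat_less_scaled) simp_all
  qed
qed


section \<open>Norms and limited entries\<close>

lemma hnorm_ge_0: "0 \<le> hnorm x"
  by (simp add: hnorm_def hsqrt_ge_0 sum_nonneg)

lemma hmod_nth_le_hnorm: "hmod (x $ i) \<le> hnorm x"
proof (rule power2_le_imp_le[OF _ hnorm_ge_0])
  show "(hmod (x $ i))\<^sup>2 \<le> (hnorm x)\<^sup>2"
    unfolding hnorm_def by (subst hsqrt_square) (auto intro: sum_nonneg member_le_sum)
qed

lemma hnorm_row_le_frobenius: "hnorm (M $ i) \<le> frobenius M"
proof (rule power2_le_imp_le)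
  have "(\<Sum>j\<in>UNIV. (hmod (M $ i $ j))\<^sup>2) \<le> (\<Sum>i\<in>UNIV. \<Sum>j\<in>UNIV. (hmod (M $ i $ j))\<^sup>2)"
    by (rule member_le_sum[where f = "\<lambda>i. \<Sum>j\<in>UNIV. (hmod (M $ i $ j))\<^sup>2"])
       (auto intro: sum_nonneg)
  then show "(hnorm (M $ i))\<^sup>2 \<le> (frobenius M)\<^sup>2"
    by (simp add: hnorm_def frobenius_def hsqrt_square sum_nonneg)
qed (simp add: frobenius_def hsqrt_ge_0 sum_nonneg)

lemma limited_hnorm:
  assumes "\<And>i. x $ i \<in> limited"
  shows "hnorm x \<in> limited"
proof -
  have "hmod (x $ i) \<in> limited" for i
    using assms[of i] by (simp add: limited_def hmod_hyperreal)
  then have "(\<Sum>i\<in>UNIV. (hmod (x $ i))\<^sup>2) \<in> limited"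
    by (intro limited_sum) (simp add: limited_power2_iff)
  then have "(hnorm x)\<^sup>2 \<in> limited"
    by (simp add: hnorm_def hsqrt_square sum_nonneg)
  then show ?thesis by (simp add: limited_power2_iff)
qed

lemma appreciable_hnorm_of_rep:
  assumes "u \<in> appreciable_reps p"
  shows "hnorm u \<in> appreciable"
proof -
  obtain c x A where c: "u = inverse c *s x" "c \<noteq> 0" "A \<in> appreciable"
      "hyper_of_real (hnorm x) = A * c"
    using assms unfolding appreciable_reps_def mag_def by blast
  have "hnorm x = hmod A * hmod c"
    using c(4) hnorm_ge_0[of x] by (metis abs_of_nonneg hmod_hyper_of_real hmod_mult)
  then have "hnorm u = hmod A"
    using c by (simp add: hnorm_scale hmod_inverse)
  then have "hmod (hnorm u) = hmod A" by (simp add: hmod_hyperreal)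
  then show ?thesis using c(3) by (simp add: appreciable_def)
qed

lemma limited_entries_of_matrix_rep:
  assumes "N \<in> appreciable_matrix_reps M"
  shows "N $ i $ j \<in> limited"
proof -
  obtain c A where c: "N = (\<chi> i j. inverse c * M $ i $ j)" "c \<noteq> 0" "A \<in> appreciable"
      "hyper_of_real (frobenius M) = A * c"
    using assms unfolding appreciable_matrix_reps_def mag_def by blast
  have "hmod (M $ i $ j) \<le> frobenius M"
    using hmod_nth_le_hnorm hnorm_row_le_frobenius by (rule order_trans)
  also have "\<dots> \<le> hmod A * hmod c"
    using c(4) by (metis abs_ge_self hmod_hyper_of_real hmod_mult)
  finally have "hmod (N $ i $ j) \<le> inverse (hmod c) * (hmod A * hmod c)"
    by (simp add: c(1) hmod_mult hmod_inverse mult_left_mono)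
  then have "hmod (N $ i $ j) \<le> hmod A"
    using c(2) by (simp add: field_simps)
  then show ?thesis
    using appreciable_limited[OF c(3)] by (rule limited_of_hmod_le)
qed

text \<open>Normalise \<open>w\<close> to norm one. Its image under \<open>P\<close> is then limited, and this image is
  \<open>P w\<close> divided by the norm of \<open>w\<close>; an infinitesimal norm would blow the appreciable
  vector \<open>P w\<close> up to an unlimited one.\<close>

lemma limited_inverse_hnorm:
  fixes P :: "'a::real_normed_field star ^ 'n ^ 'm" and w :: "'a star ^ 'n"
  assumes P: "\<And>i j. P $ i $ j \<in> limited"
    and Pw: "hnorm (P *v w) \<in> appreciable"
  shows "w \<noteq> 0" and "inverse (hnorm w) \<in> limited"
proof -
  have "hnorm (P *v w) \<noteq> 0"
    using Pw by (rule appreciable_neq_0)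
  then show "w \<noteq> 0"
    by (auto simp: hnorm_eq_0_iff)
  then have pos: "0 < hnorm w"
    using hnorm_ge_0[of w] by (simp add: hnorm_eq_0_iff less_le)
  define c :: "'a star" where "c = inverse (hyper_of_real (hnorm w))"
  have c: "hmod c = inverse (hnorm w)"
    using pos by (simp add: c_def hmod_inverse hmod_hyper_of_real)
  have "hmod ((c *s w) $ j) \<le> 1" for j
    using hmod_nth_le_hnorm[of w j] pos
    by (simp add: hmod_mult c field_simps)
  then have "hmod ((c *s w) $ j) < of_nat 2" for j
    by (rule le_less_trans) simp
  then have "(c *s w) $ j \<in> limited" for j
    unfolding limited_def by blast
  then have "(P *v (c *s w)) $ i \<in> limited" for i
    unfolding matrix_vector_mult_def vec_lambda_beta by (intro limited_sum limited_mult P)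
  then have "hnorm (P *v (c *s w)) \<in> limited"
    by (rule limited_hnorm)
  then have "inverse (hnorm w) * hnorm (P *v w) \<in> limited"
    by (simp add: vector_scalar_commute hnorm_scale c)
  then have "inverse (hnorm w) * hnorm (P *v w) * inverse (hnorm (P *v w)) \<in> limited"
    by (rule limited_mult[OF _ appreciable_limited[OF appreciable_inverse[OF Pw]]])
  then show "inverse (hnorm w) \<in> limited"
    using \<open>hnorm (P *v w) \<noteq> 0\<close> by (simp add: mult.assoc)
qed


section \<open>Inverses and conjugate transposes\<close>

lemma matrix_inv_inverse:
  assumes "invertible N"
  shows "N ** matrix_inv N = mat 1" and "matrix_inv N ** N = mat 1"
  using someI_ex[OF assms[unfolded invertible_def]] by (auto simp: matrix_inv_def)

lemma limited_det:
  fixes N :: "'a::real_normed_field star ^ 'n ^ 'n"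
  assumes "\<And>i j. N $ i $ j \<in> limited"
  shows "det N \<in> limited"
proof -
  have "of_int (sign \<sigma>) \<in> (limited :: 'a star set)" for \<sigma> :: "'n \<Rightarrow> 'n"
    using limited_1 by (auto simp: sign_def limited_def hmod_minus)
  then show ?thesis
    unfolding det_def by (intro limited_sum limited_mult limited_prod assms)
qed

text \<open>Column \<open>j\<close> of the inverse solves \<open>N x = e\<^sub>j\<close>, and Cramer's rule gives each of its
  entries as a determinant of limited entries divided by \<open>det N\<close>.\<close>

lemma limited_matrix_inv:
  assumes N: "\<And>i j. N $ i $ j \<in> limited" and det: "det N \<in> appreciable"
  shows "matrix_inv N $ i $ j \<in> limited"
proof -
  define x where "x = matrix_inv N *v axis j 1"
  have det0: "det N \<noteq> 0"
    using det by (rule appreciable_neq_0)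
  have "N *v x = axis j 1"
    using det0 by (simp add: x_def matrix_vector_mul_assoc matrix_inv_inverse invertible_det_nz)
  then have "x = (\<chi> k. det (\<chi> i l. if l = k then axis j 1 $ i else N $ i $ l) / det N)"
    using cramer[OF det0] by blast
  then have "x $ i = det (\<chi> i' l. if l = i then axis j 1 $ i' else N $ i' $ l) * inverse (det N)"
    by (simp add: divide_inverse)
  moreover have "\<dots> \<in> limited"
    by (intro limited_mult limited_det appreciable_limited[OF appreciable_inverse[OF det]])
       (auto simp: axis_def limited_0 limited_1 N)
  moreover have "x $ i = matrix_inv N $ i $ j"
    by (simp add: x_def matrix_vector_mult_def axis_def if_distrib cong: if_cong)
  ultimately show ?thesis by simp
qed

lemma conjugate_one: "conjugate 1 = (1 :: 'a::conjugatable_field)"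
proof -
  have "conjugate 1 * conjugate 1 = (conjugate 1 :: 'a)"
    by (simp add: conjugate_dist_mul[symmetric])
  moreover have "conjugate 1 \<noteq> (0 :: 'a)" by simp
  ultimately show ?thesis by simp
qed

lemma conj_transpose_mat_1: "conj_transpose (mat 1) = (mat 1 :: 'a::conjugatable_field ^ 'n ^ 'n)"
  by (auto simp: conj_transpose_def mat_def vec_eq_iff conjugate_one)

lemma conj_transpose_mul: "conj_transpose (A ** B) = conj_transpose B ** conj_transpose A"
  by (simp add: conj_transpose_def matrix_matrix_mult_def vec_eq_iff sum_conjugate
      conjugate_dist_mul mult.commute)

lemma herm_product_conj_transpose:
  "herm_product u (conj_transpose B *v v) = herm_product (B *v u) v"
proof -
  have "herm_product u (conj_transpose B *v v)
      = (\<Sum>i\<in>UNIV. \<Sum>j\<in>UNIV. conjugate (u $ i) * (conjugate (B $ j $ i) * v $ j))"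
    by (simp add: herm_product_def conj_transpose_def matrix_vector_mult_def sum_distrib_left)
  also have "\<dots> = (\<Sum>j\<in>UNIV. \<Sum>i\<in>UNIV. conjugate (u $ i) * (conjugate (B $ j $ i) * v $ j))"
    by (rule sum.swap)
  also have "\<dots> = herm_product (B *v u) v"
    by (simp add: herm_product_def matrix_vector_mult_def sum_conjugate conjugate_dist_mul
        sum_distrib_left mult_ac)
  finally show ?thesis .
qed

lemma herm_product_inverse_conj_transpose:
  assumes "invertible N"
  shows "herm_product (N *v u) (conj_transpose (matrix_inv N) *v v) = herm_product u v"
  by (simp add: herm_product_conj_transpose matrix_vector_mul_assoc matrix_inv_inverse assms)

lemma conj_transpose_matrix_inv_cancel:
  assumes "invertible N"
  shows "conj_transpose N *v (conj_transpose (matrix_inv N) *v v) = v"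
  by (simp add: matrix_vector_mul_assoc conj_transpose_mul[symmetric] matrix_inv_inverse
      conj_transpose_mat_1 assms)


section \<open>Almost incidence\<close>

lemma normalized_in_appreciable_reps:
  assumes "w \<noteq> 0"
  shows "inverse (hyper_of_real (hnorm w)) *s w \<in> appreciable_reps (proj_class w)"
proof -
  have "hyper_of_real (hnorm w) \<noteq> (0 :: 'a star)"
    using assms by (metis abs_eq_0_iff hmod_eq_0_iff hmod_hyper_of_real hnorm_eq_0_iff)
  then show ?thesis
    unfolding appreciable_reps_def using assms mag_self by blast
qed

text \<open>Dividing two vectors by their norms multiplies their product by limited factors as soon as
  both norms are bounded below by a standard positive number, and such factors preserve
  infinitesimals.\<close>

lemma almost_incident_proj_classI:
  assumes "x \<noteq> 0" "inverse (hnorm x) \<in> limited" "y \<noteq> 0" "inverse (hnorm y) \<in> limited"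
    and "herm_product x y \<in> infinitesimal"
  shows "almost_incident (proj_class x) (proj_class y)"
proof -
  have lim: "inverse (hyper_of_real (hnorm z)) \<in> (limited :: 'a star set)"
    if "inverse (hnorm z) \<in> limited" for z :: "'a star ^ 3"
    using that by (simp add: limited_def hmod_inverse hmod_hyper_of_real hmod_hyperreal)
  have "herm_product (inverse (hyper_of_real (hnorm x)) *s x)
      (inverse (hyper_of_real (hnorm y)) *s y) \<in> infinitesimal"
    unfolding herm_product_scale using assms lim
    by (intro limited_mult_infinitesimal limited_mult) (simp_all add: limited_conjugate)
  then show ?thesis
    unfolding almost_incident_def using assms normalized_in_appreciable_reps by blast
qed

lemma almost_incident_image:
  fixes p l :: "'a::normed_conjugatable_field star proj_plane"
  assumes M: "nonsingular M" and pl: "almost_incident p l"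
    and N: "N \<in> appreciable_matrix_reps M"
    and u: "u \<in> appreciable_reps p" and v: "v \<in> appreciable_reps l"
  shows "almost_incident (proj_class (N *v u)) (proj_class (conj_transpose (matrix_inv N) *v v))"
proof -
  have det: "det N \<in> appreciable"
    using M N by (simp add: nonsingular_iff)
  then have inv: "invertible N"
    by (simp add: invertible_det_nz appreciable_neq_0)
  have limN: "N $ i $ j \<in> limited" for i j
    using N by (rule limited_entries_of_matrix_rep)
  have back_u: "matrix_inv N *v (N *v u) = u"
    by (simp add: matrix_vector_mul_assoc matrix_inv_inverse inv)
  have back_v: "conj_transpose N *v (conj_transpose (matrix_inv N) *v v) = v"
    by (rule conj_transpose_matrix_inv_cancel[OF inv])
  have lim_inv: "matrix_inv N $ i $ j \<in> limited" for i j
    by (rule limited_matrix_inv[OF limN det])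
  have lim_ct: "conj_transpose N $ i $ j \<in> limited" for i j
    using limN by (simp add: conj_transpose_def limited_conjugate)
  have herm: "herm_product (N *v u) (conj_transpose (matrix_inv N) *v v) \<in> infinitesimal"
    using pl u v by (simp add: herm_product_inverse_conj_transpose inv almost_incident_iff)
  show ?thesis
    using limited_inverse_hnorm[of "matrix_inv N" "N *v u", OF lim_inv]
      limited_inverse_hnorm[of "conj_transpose N" "conj_transpose (matrix_inv N) *v v", OF lim_ct]
      appreciable_hnorm_of_rep[OF u] appreciable_hnorm_of_rep[OF v] herm
    by (intro almost_incident_proj_classI) (simp_all add: back_u back_v)
qed

theorem theorem4p16:
  shows "(\<forall>(p :: hyperreal proj_plane) (l :: hyperreal proj_plane) (M :: hyperreal ^ 3 ^ 3).
            invertible M \<and> nonsingular M \<and> almost_incident p l \<longrightarrow>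
            (\<forall>M\<^sub>A \<in> appreciable_matrix_reps M. \<forall>p\<^sub>A \<in> appreciable_reps p. \<forall>l\<^sub>A \<in> appreciable_reps l.
               almost_incident (proj_class (M\<^sub>A *v p\<^sub>A))
                 (proj_class (conj_transpose (matrix_inv M\<^sub>A) *v l\<^sub>A))))
       \<and> (\<forall>(p :: hypercomplex proj_plane) (l :: hypercomplex proj_plane) (M :: hypercomplex ^ 3 ^ 3).
            invertible M \<and> nonsingular M \<and> almost_incident p l \<longrightarrow>
            (\<forall>M\<^sub>A \<in> appreciable_matrix_reps M. \<forall>p\<^sub>A \<in> appreciable_reps p. \<forall>l\<^sub>A \<in> appreciable_reps l.
               almost_incident (proj_class (M\<^sub>A *v p\<^sub>A))
                 (proj_class (conj_transpose (matrix_inv M\<^sub>A) *v l\<^sub>A))))"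
  by (auto intro: almost_incident_image)

end
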